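(* Let $(G,w)$ be a weighted graph with a pseudoultrametrizable weight $w$, and let $\mathfrak{U}_w$ be the set of all pseudoultrametrics on $V(G)$ extending $w$. If $G$ is connected, then the subdominant pseudoultrametric $\rho_w$ is the greatest element of the poset $(\mathfrak{U}_w,\preceq)$. Conversely, if $(\mathfrak{U}_w,\preceq)$ has the greatest element, then $G$ is connected.
   Context: A graph $G=(V(G),E(G))$ has a nonempty (possibly infinite) vertex set $V(G)$, and its edge set $E(G)$ (possibly empty) is a set of unordered pairs of distinct vertices. A path is a finite graph with at least one edge whose vertices can be enumerated without repetition as $v_1,\dots,v_n$ so that $\{v_i,v_j\}$ is an edge iff $|i-j|=1$; it connects $v_1$ and $v_n$. $G$ is connected if any two distinct vertices are connected by a path in $G$ (a subgraph of $G$, not necessarily induced). A weighted graph $(G,w)$ is a graph $G$ with a function (weight) $w:E(G)\to\mathbb{R}^+=[0,+\infty)$. A pseudoultrametric on a set $X$ is a function $d:X\times X\to\mathbb{R}^+$ with $d(x,y)=d(y,x)$, $d(x,x)=0$ and $d(x,y)\le\max\{d(x,z),d(z,y)\}$ for all $x,y,z\in X$. A pseudoultrametric $d$ on $V(G)$ extends $w$ if $d(x,y)=w(\{x,y\})$ for every $\{x,y\}\in E(G)$. The weight $w$ is pseudoultrametrizable if some pseudoultrametric on $V(G)$ extends $w$. The order is pointwise: $\rho_1\preceq\rho_2$ iff $\rho_1(x,y)\le\rho_2(x,y)$ for all $x,y\in V(G)$. The subdominant pseudoultrametric for $w$ is the greatest element, with respect to $\preceq$, of the set of pseudoultrametrics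 $\rho$ on $V(G)$ with $\rho(u,v)\le w(\{u,v\})$ for every $\{u,v\}\in E(G)$. For connected $G$ it is given by $\rho_w(x,x)=0$ and, for $x\ne y$, $\rho_w(x,y)=\inf_{P\in\mathfrak{P}_{x,y}}\max_{e\in E(P)}w(e)$, where $\mathfrak{P}_{x,y}$ is the set of paths in $G$ connecting $x$ and $y$. *)

theory Defs
  imports Complex_Main "HOL-Library.FuncSet" "HOL-Algebra.Order"
begin

section \<open>Graphs\<close>

text \<open>
  Graphs are simple and undirected with a nonempty, possibly infinite, vertex set. (The AFP
  entry on graph theory only provides symmetric digraphs, and its locale \<open>graph\<close> is finite.)
\<close>

type_synonym 'a graph = "'a set \<times> 'a set set"

abbreviation verts :: "'a graph \<Rightarrow> 'a set" where "verts G \<equiv> fst G"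
abbreviation edges :: "'a graph \<Rightarrow> 'a set set" where "edges G \<equiv> snd G"

definition simple_graph :: "'a graph \<Rightarrow> bool" where
  "simple_graph G \<longleftrightarrow>
     verts G \<noteq> {} \<and> edges G \<subseteq> {{x, y} | x y. x \<in> verts G \<and> y \<in> verts G \<and> x \<noteq> y}"

definition subgraph :: "'a graph \<Rightarrow> 'a graph \<Rightarrow> bool" where
  "subgraph H G \<longleftrightarrow> simple_graph H \<and> verts H \<subseteq> verts G \<and> edges H \<subseteq> edges G"

definition path_connecting :: "'a graph \<Rightarrow> 'a \<Rightarrow> 'a \<Rightarrow> bool" where
  "path_connecting P x y \<longleftrightarrow>
     simple_graph P \<and> finite (verts P) \<and> edges P \<noteq> {} \<and>
     (\<exists>vs. distinct vs \<and> set vs = verts P \<and>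
        (\<forall>i < length vs. \<forall>j < length vs.
           {vs ! i, vs ! j} \<in> edges P \<longleftrightarrow> \<bar>int i - int j\<bar> = 1) \<and>
        hd vs = x \<and> last vs = y)"

definition paths_between :: "'a graph \<Rightarrow> 'a \<Rightarrow> 'a \<Rightarrow> 'a graph set" where
  "paths_between G x y = {P. path_connecting P x y \<and> subgraph P G}"

definition connected_graph :: "'a graph \<Rightarrow> bool" where
  "connected_graph G \<longleftrightarrow>
     (\<forall>x \<in> verts G. \<forall>y \<in> verts G. x \<noteq> y \<longrightarrow> paths_between G x y \<noteq> {})"

definition weighted_graph :: "'a graph \<Rightarrow> ('a set \<Rightarrow> real) \<Rightarrow> bool" where
  "weighted_graph G w \<longleftrightarrow> simple_graph G \<and> w \<in> edges G \<rightarrow> {0..}"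


section \<open>Pseudoultrametrics\<close>

text \<open>
  Functions on \<open>X \<times> X\<close> are extensional (\<open>\<rightarrow>\<^sub>E\<close>), so that the pointwise order is antisymmetric
  and a greatest element is unique as a function.
\<close>

definition pseudoultrametrics :: "'a set \<Rightarrow> ('a \<times> 'a \<Rightarrow> real) set" where
  "pseudoultrametrics X = {d \<in> X \<times> X \<rightarrow>\<^sub>E {0..}.
     (\<forall>x\<in>X. \<forall>y\<in>X. d (x, y) = d (y, x)) \<and>
     (\<forall>x\<in>X. d (x, x) = 0) \<and>
     (\<forall>x\<in>X. \<forall>y\<in>X. \<forall>z\<in>X. d (x, y) \<le> max (d (x, z)) (d (z, y)))}"

definition pseudoultrametric_order :: "'a set \<Rightarrow> ('a \<times> 'a \<Rightarrow> real) gorder" where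
  "pseudoultrametric_order X =
     \<lparr>carrier = pseudoultrametrics X, eq = (=),
      le = (\<lambda>d1 d2. \<forall>x\<in>X. \<forall>y\<in>X. d1 (x, y) \<le> d2 (x, y))\<rparr>"

definition extends :: "'a graph \<Rightarrow> ('a set \<Rightarrow> real) \<Rightarrow> ('a \<times> 'a \<Rightarrow> real) \<Rightarrow> bool" where
  "extends G w d \<longleftrightarrow> (\<forall>x y. {x, y} \<in> edges G \<longrightarrow> d (x, y) = w {x, y})"

definition extensions :: "'a graph \<Rightarrow> ('a set \<Rightarrow> real) \<Rightarrow> ('a \<times> 'a \<Rightarrow> real) set" where
  "extensions G w = {d \<in> pseudoultrametrics (verts G). extends G w d}"

definition pseudoultrametrizable :: "'a graph \<Rightarrow> ('a set \<Rightarrow> real) \<Rightarrow> bool" where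
  "pseudoultrametrizable G w \<longleftrightarrow> (\<exists>d \<in> pseudoultrametrics (verts G). extends G w d)"

definition minorants :: "'a graph \<Rightarrow> ('a set \<Rightarrow> real) \<Rightarrow> ('a \<times> 'a \<Rightarrow> real) set" where
  "minorants G w = {d \<in> pseudoultrametrics (verts G).
     \<forall>u v. {u, v} \<in> edges G \<longrightarrow> d (u, v) \<le> w {u, v}}"

text \<open>
  For connected \<open>G\<close> the description below is satisfied by exactly one function, which is the
  usual infimum over paths; see \<open>greatest_minorant_path_inf\<close> and \<open>subdominant_eq_path_inf\<close>.
\<close>

definition subdominant :: "'a graph \<Rightarrow> ('a set \<Rightarrow> real) \<Rightarrow> 'a \<times> 'a \<Rightarrow> real" where
  "subdominant G w =
     (THE \<rho>. greatest (pseudoultrametric_order (verts G)) \<rho> (minorants G w))"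

definition path_inf :: "'a graph \<Rightarrow> ('a set \<Rightarrow> real) \<Rightarrow> 'a \<times> 'a \<Rightarrow> real" where
  "path_inf G w = (\<lambda>(x, y) \<in> verts G \<times> verts G.
     if x = y then 0 else (INF P \<in> paths_between G x y. Max (w ` edges P)))"


section \<open>The order and the path formula\<close>

lemma pseudoultrametricsD:
  assumes "d \<in> pseudoultrametrics X"
  shows "d \<in> extensional (X \<times> X)"
    and "x \<in> X \<Longrightarrow> y \<in> X \<Longrightarrow> 0 \<le> d (x, y)"
    and "x \<in> X \<Longrightarrow> y \<in> X \<Longrightarrow> d (x, y) = d (y, x)"
    and "x \<in> X \<Longrightarrow> d (x, x) = 0"
    and "x \<in> X \<Longrightarrow> y \<in> X \<Longrightarrow> z \<in> X \<Longrightarrow> d (x, y) \<le> max (d (x, z)) (d (z, y))"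
  using assms by (auto simp: pseudoultrametrics_def PiE_iff)

lemma partial_order_pseudoultrametrics: "partial_order (pseudoultrametric_order X)"
proof -
  have antisym: "d1 = d2"
    if "d1 \<in> pseudoultrametrics X" "d2 \<in> pseudoultrametrics X"
      "\<forall>x\<in>X. \<forall>y\<in>X. d1 (x, y) \<le> d2 (x, y)" "\<forall>x\<in>X. \<forall>y\<in>X. d2 (x, y) \<le> d1 (x, y)" for d1 d2
    by (rule extensionalityI[of _ "X \<times> X"]) (use that pseudoultrametricsD(1) in \<open>force+\<close>)
  show ?thesis
  proof unfold_locales
    fix x y assume "x \<in> carrier (pseudoultrametric_order X)" "y \<in> carrier (pseudoultrametric_order X)"
      "x \<sqsubseteq>\<^bsub>pseudoultrametric_order X\<^esub> y" "y \<sqsubseteq>\<^bsub>pseudoultrametric_order X\<^esub> x"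
    then show "x .=\<^bsub>pseudoultrametric_order X\<^esub> y"
      using antisym by (simp add: pseudoultrametric_order_def)
  next
    fix x y z assume "x \<sqsubseteq>\<^bsub>pseudoultrametric_order X\<^esub> y" "y \<sqsubseteq>\<^bsub>pseudoultrametric_order X\<^esub> z"
    then show "x \<sqsubseteq>\<^bsub>pseudoultrametric_order X\<^esub> z"
      by (simp add: pseudoultrametric_order_def) (meson order_trans)
  qed (simp_all add: pseudoultrametric_order_def)
qed

lemma greatest_iff:
  "greatest (pseudoultrametric_order X) \<rho> A \<longleftrightarrow>
     A \<subseteq> pseudoultrametrics X \<and> \<rho> \<in> A \<and>
     (\<forall>d\<in>A. \<forall>x\<in>X. \<forall>y\<in>X. d (x, y) \<le> \<rho> (x, y))"
  by (auto simp: greatest_def pseudoultrametric_order_def)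

text \<open>Adjacency through edges of weight at most \<open>t\<close>.\<close>

definition thr :: "'a graph \<Rightarrow> ('a set \<Rightarrow> real) \<Rightarrow> real \<Rightarrow> ('a \<times> 'a) set" where
  "thr G w t = {(x, y). {x, y} \<in> edges G \<and> w {x, y} \<le> t}"

lemma edgeD:
  assumes "simple_graph G" "{x, y} \<in> edges G"
  shows "x \<in> verts G" "y \<in> verts G" "x \<noteq> y"
  using assms unfolding simple_graph_def by (fastforce simp: doubleton_eq_iff)+

lemma edgeE:
  assumes "simple_graph G" "e \<in> edges G"
  obtains x y where "e = {x, y}" "x \<in> verts G" "y \<in> verts G" "x \<noteq> y"
  using assms unfolding simple_graph_def by blast

lemma finite_edges:
  assumes "simple_graph P" "finite (verts P)"
  shows "finite (edges P)"
proof -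
  have "edges P \<subseteq> Pow (verts P)" using assms(1) edgeE by blast
  then show ?thesis using assms(2) finite_subset by blast
qed

lemma path_rtrancl:
  assumes P: "P \<in> paths_between G x y"
  shows "(x, y) \<in> (thr G w (Max (w ` edges P)))\<^sup>*"
proof -
  let ?R = "thr G w (Max (w ` edges P))"
  have sub: "edges P \<subseteq> edges G" and fin: "finite (edges P)"
    using P finite_edges[of P] by (auto simp: paths_between_def path_connecting_def subgraph_def)
  obtain vs where vs: "\<And>i j. i < length vs \<Longrightarrow> j < length vs \<Longrightarrow>
       {vs ! i, vs ! j} \<in> edges P \<longleftrightarrow> \<bar>int i - int j\<bar> = 1"
     and ends: "hd vs = x" "last vs = y" and "set vs = verts P"
    using P unfolding paths_between_def path_connecting_def by blast
  then have ne: "vs \<noteq> []"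
    using P by (auto simp: paths_between_def path_connecting_def simple_graph_def)
  have "(hd vs, vs ! k) \<in> ?R\<^sup>*" if "k < length vs" for k
    using that
  proof (induction k)
    case 0
    then show ?case using ne by (simp add: hd_conv_nth)
  next
    case (Suc k)
    have "{vs ! k, vs ! Suc k} \<in> edges P" using vs[of k "Suc k"] Suc.prems by simp
    then have "(vs ! k, vs ! Suc k) \<in> ?R" using sub fin by (auto simp: thr_def)
    then show ?case using Suc by (simp add: rtrancl.rtrancl_into_rtrancl)
  qed
  from this[of "length vs - 1"] show ?thesis using ne ends by (simp add: last_conv_nth)
qed

lemma rtrancl_distinct_list:
  assumes "(x, y) \<in> R\<^sup>*"
  shows "\<exists>vs. vs \<noteq> [] \<and> distinct vs \<and> hd vs = x \<and> last vs = y \<and>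
    (\<forall>i. Suc i < length vs \<longrightarrow> (vs ! i, vs ! Suc i) \<in> R)"
  using assms
proof (induction rule: rtrancl_induct)
  case base
  show ?case by (rule exI[of _ "[x]"]) simp
next
  case (step y z)
  then obtain vs where vs: "vs \<noteq> []" "distinct vs" "hd vs = x" "last vs = y"
    "\<forall>i. Suc i < length vs \<longrightarrow> (vs ! i, vs ! Suc i) \<in> R" by blast
  show ?case
  proof (cases "z \<in> set vs")
    case True
    then obtain k where k: "k < length vs" "vs ! k = z" by (auto simp: in_set_conv_nth)
    have "last (take (Suc k) vs) = z" using k by (simp add: take_Suc_conv_app_nth)
    then show ?thesis using vs k
      by (intro exI[of _ "take (Suc k) vs"]) (auto simp: hd_take)
  next
    case False
    have "((vs @ [z]) ! i, (vs @ [z]) ! Suc i) \<in> R" if "Suc i < length (vs @ [z])" for i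
    proof (cases "Suc i < length vs")
      case True
      then show ?thesis using vs by (simp add: nth_append)
    next
      case False
      then have "i = length vs - 1" using that by simp
      then show ?thesis using vs step.hyps(2) by (simp add: nth_append last_conv_nth)
    qed
    then show ?thesis using vs False by (intro exI[of _ "vs @ [z]"]) auto
  qed
qed

lemma rtrancl_path:
  assumes G: "simple_graph G" and "(x, y) \<in> (thr G w t)\<^sup>*" "x \<noteq> y"
  shows "\<exists>P \<in> paths_between G x y. Max (w ` edges P) \<le> t"
proof -
  obtain vs where vs: "vs \<noteq> []" "distinct vs" "hd vs = x" "last vs = y"
    and R: "\<And>i. Suc i < length vs \<Longrightarrow> (vs ! i, vs ! Suc i) \<in> thr G w t"
    using rtrancl_distinct_list[OF assms(2)] by blast
  have len: "Suc 0 < length vs"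
  proof (rule ccontr)
    assume "\<not> Suc 0 < length vs"
    then have "length vs = 1" using vs(1) by (cases vs) auto
    then show False using vs(3,4) assms(3) by (auto simp: length_Suc_conv)
  qed
  define EP where "EP = {{vs ! i, vs ! Suc i} | i. Suc i < length vs}"
  have EPe: "\<exists>i. e = {vs ! i, vs ! Suc i} \<and> Suc i < length vs" if "e \<in> EP" for e
    using that by (auto simp: EP_def)
  have simple: "simple_graph (set vs, EP)"
  proof -
    have "e \<in> {{x, y} | x y. x \<in> set vs \<and> y \<in> set vs \<and> x \<noteq> y}" if e: "e \<in> EP" for e
    proof -
      obtain i where "e = {vs ! i, vs ! Suc i}" "Suc i < length vs" using EPe[OF e] by blast
      moreover from this have "vs ! i \<noteq> vs ! Suc i" using vs(2) by (simp add: nth_eq_iff_index_eq)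
      moreover have "vs ! i \<in> set vs" "vs ! Suc i \<in> set vs"
        using \<open>Suc i < length vs\<close> by auto
      ultimately show ?thesis by blast
    qed
    then show ?thesis using vs(1) by (auto simp: simple_graph_def)
  qed
  have iff: "{vs ! i, vs ! j} \<in> EP \<longleftrightarrow> \<bar>int i - int j\<bar> = 1"
    if "i < length vs" "j < length vs" for i j
  proof
    assume "{vs ! i, vs ! j} \<in> EP"
    then obtain k where k: "{vs ! i, vs ! j} = {vs ! k, vs ! Suc k}" "Suc k < length vs"
      using EPe by blast
    then show "\<bar>int i - int j\<bar> = 1"
      using that vs(2) by (auto simp: doubleton_eq_iff nth_eq_iff_index_eq)
  next
    assume "\<bar>int i - int j\<bar> = 1"
    then have "i = Suc j \<or> j = Suc i" by linarith
    then show "{vs ! i, vs ! j} \<in> EP" using that by (auto simp: EP_def insert_commute)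
  qed
  have EP_ne: "EP \<noteq> {}" using len by (auto simp: EP_def)
  have EP_sub: "EP \<subseteq> edges G" and EP_le: "\<And>e. e \<in> EP \<Longrightarrow> w e \<le> t"
    using R by (auto simp: EP_def thr_def)
  have V_sub: "set vs \<subseteq> verts G"
  proof
    fix v assume "v \<in> set vs"
    then obtain i where i: "i < length vs" "v = vs ! i" by (auto simp: in_set_conv_nth)
    obtain j where "j < length vs" "\<bar>int i - int j\<bar> = 1"
    proof (cases i)
      case 0
      then show ?thesis using that[of 1] len by simp
    next
      case (Suc k)
      then show ?thesis using that[of k] i by simp
    qed
    then have "{v, vs ! j} \<in> edges G" using iff i EP_sub by blast
    then show "v \<in> verts G" using edgeD(1)[OF G] by blast
  qed
  have "path_connecting (set vs, EP) x y"
    unfolding path_connecting_def using simple EP_ne vs iff by auto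
  then have P: "(set vs, EP) \<in> paths_between G x y"
    using simple V_sub EP_sub by (simp add: paths_between_def subgraph_def)
  moreover have "Max (w ` EP) \<le> t"
    using EP_ne EP_le finite_edges[OF simple] by (subst Max_le_iff) auto
  ultimately show ?thesis by (intro bexI[of _ "(set vs, EP)"]) auto
qed

lemma path_Max_nonneg:
  assumes "weighted_graph G w" "P \<in> paths_between G x y"
  shows "0 \<le> Max (w ` edges P)"
proof -
  have "finite (edges P)" "edges P \<noteq> {}" "edges P \<subseteq> edges G"
    using assms(2) finite_edges[of P] by (auto simp: paths_between_def path_connecting_def subgraph_def)
  moreover from this obtain e where "e \<in> edges P" by blast
  ultimately have "0 \<le> w e" "w e \<le> Max (w ` edges P)"
    using assms(1) by (auto simp: weighted_graph_def)
  then show ?thesis by linarith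
qed

lemma path_inf_le:
  assumes "weighted_graph G w" "x \<in> verts G" "y \<in> verts G" "(x, y) \<in> (thr G w t)\<^sup>*" "0 \<le> t"
  shows "path_inf G w (x, y) \<le> t"
proof (cases "x = y")
  case True
  then show ?thesis using assms by (simp add: path_inf_def)
next
  case False
  then obtain P where P: "P \<in> paths_between G x y" "Max (w ` edges P) \<le> t"
    using rtrancl_path[of G x y w t] assms by (auto simp: weighted_graph_def)
  have "bdd_below ((\<lambda>P. Max (w ` edges P)) ` paths_between G x y)"
    using path_Max_nonneg[OF assms(1)] by (intro bdd_belowI2[of _ 0])
  then have "path_inf G w (x, y) \<le> Max (w ` edges P)"
    using P False assms by (auto simp: path_inf_def intro: cINF_lower)
  then show ?thesis using P by linarith
qed

lemma path_inf_less:
  assumes "connected_graph G" "x \<in> verts G" "y \<in> verts G" "path_inf G w (x, y) < t"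
  shows "(x, y) \<in> (thr G w t)\<^sup>*"
proof (cases "x = y")
  case False
  then have "paths_between G x y \<noteq> {}" using assms by (auto simp: connected_graph_def)
  moreover have "(INF P \<in> paths_between G x y. Max (w ` edges P)) < t"
    using assms False by (simp add: path_inf_def)
  ultimately obtain P where P: "P \<in> paths_between G x y" "Max (w ` edges P) < t"
    using cInf_lessD[of "(\<lambda>P. Max (w ` edges P)) ` paths_between G x y" t] by blast
  moreover have "thr G w (Max (w ` edges P)) \<subseteq> thr G w t" using P by (auto simp: thr_def)
  ultimately show ?thesis using path_rtrancl[OF P(1), of w] rtrancl_mono by blast
qed simp

lemma rtrancl_thr_sym: "(x, y) \<in> (thr G w t)\<^sup>* \<Longrightarrow> (y, x) \<in> (thr G w t)\<^sup>*"
  by (rule symD[OF sym_rtrancl]) (auto simp: sym_def thr_def insert_commute)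

lemma greatest_minorant_path_inf:
  assumes W: "weighted_graph G w" and C: "connected_graph G"
  shows "greatest (pseudoultrametric_order (verts G)) (path_inf G w) (minorants G w)"
proof -
  let ?V = "verts G" and ?r = "path_inf G w"
  have G: "simple_graph G" using W by (simp add: weighted_graph_def)
  have nonneg: "0 \<le> ?r (x, y)" if "x \<in> ?V" "y \<in> ?V" for x y
  proof (cases "x = y")
    case False
    then have "0 \<le> (INF P \<in> paths_between G x y. Max (w ` edges P))"
      using C that path_Max_nonneg[OF W] by (intro cINF_greatest) (auto simp: connected_graph_def)
    then show ?thesis using that False by (simp add: path_inf_def)
  qed (use that in \<open>simp add: path_inf_def\<close>)
  have sym: "?r (x, y) \<le> ?r (y, x)" if "x \<in> ?V" "y \<in> ?V" for x y
  proof (rule dense_ge)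
    fix t assume t: "?r (y, x) < t"
    have "0 \<le> t" using nonneg[of y x] that t by linarith
    then show "?r (x, y) \<le> t"
      by (rule path_inf_le[OF W that rtrancl_thr_sym[OF path_inf_less[OF C that(2,1) t]]])
  qed
  have tri: "?r (x, y) \<le> max (?r (x, z)) (?r (z, y))" if "x \<in> ?V" "y \<in> ?V" "z \<in> ?V" for x y z
  proof (rule dense_ge)
    fix t assume t: "max (?r (x, z)) (?r (z, y)) < t"
    have "0 \<le> t" using nonneg[of x z] that t by simp
    moreover have "(x, y) \<in> (thr G w t)\<^sup>*"
      using path_inf_less[OF C, of x z w t] path_inf_less[OF C, of z y w t] that t
        rtrancl_trans by fastforce
    ultimately show "?r (x, y) \<le> t" using path_inf_le[OF W] that by blast
  qed
  have pum: "?r \<in> pseudoultrametrics ?V"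
  proof -
    have "?r \<in> ?V \<times> ?V \<rightarrow>\<^sub>E {0..}" using nonneg by (auto simp: PiE_iff) (simp add: path_inf_def)
    moreover have "\<forall>x\<in>?V. ?r (x, x) = 0" by (simp add: path_inf_def)
    moreover have "\<forall>x\<in>?V. \<forall>y\<in>?V. ?r (x, y) = ?r (y, x)" using sym by (simp add: order_antisym)
    ultimately show ?thesis using tri by (simp add: pseudoultrametrics_def)
  qed
  have le_w: "?r (u, v) \<le> w {u, v}" if "{u, v} \<in> edges G" for u v
  proof (rule path_inf_le[OF W])
    show "(u, v) \<in> (thr G w (w {u, v}))\<^sup>*" using that by (auto simp: thr_def)
    show "0 \<le> w {u, v}" using W that by (auto simp: weighted_graph_def)
  qed (use edgeD[OF G that] in auto)
  have max: "d (x, y) \<le> ?r (x, y)"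
    if d: "d \<in> minorants G w" and xy: "x \<in> ?V" "y \<in> ?V" for d x y
  proof (rule dense_ge)
    fix t assume t: "?r (x, y) < t"
    have dp: "d \<in> pseudoultrametrics ?V"
      and dw: "\<And>u v. {u, v} \<in> edges G \<Longrightarrow> d (u, v) \<le> w {u, v}"
      using d by (auto simp: minorants_def)
    have t0: "0 \<le> t" using nonneg[OF xy] t by linarith
    have "(x, y) \<in> (thr G w t)\<^sup>*" by (rule path_inf_less[OF C xy t])
    then have "y \<in> ?V \<and> d (x, y) \<le> t"
    proof (induction rule: rtrancl_induct)
      case base
      then show ?case using xy t0 pseudoultrametricsD(4)[OF dp] by simp
    next
      case (step y z)
      then have e: "{y, z} \<in> edges G" "w {y, z} \<le> t" by (auto simp: thr_def)
      then have "d (y, z) \<le> t" using dw by fastforce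
      moreover have "z \<in> ?V" using edgeD[OF G e(1)] by simp
      ultimately show ?case
        using pseudoultrametricsD(5)[OF dp, of x z y] step.IH xy by auto
    qed
    then show "d (x, y) \<le> t" by simp
  qed
  show ?thesis
    unfolding greatest_iff using pum le_w max by (auto simp: minorants_def)
qed

lemma subdominant_eq_path_inf:
  assumes "weighted_graph G w" "connected_graph G"
  shows "subdominant G w = path_inf G w"
  unfolding subdominant_def
proof (rule the_equality)
  show "greatest (pseudoultrametric_order (verts G)) (path_inf G w) (minorants G w)"
    by (rule greatest_minorant_path_inf[OF assms])
next
  fix \<rho> assume "greatest (pseudoultrametric_order (verts G)) \<rho> (minorants G w)"
  then show "\<rho> = path_inf G w"
    by (rule partial_order.greatest_unique[OF partial_order_pseudoultrametrics _
          greatest_minorant_path_inf[OF assms]])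
qed

end

theory Submission
  imports Defs
begin

text \<open>
  If \<open>G\<close> is connected, the subdominant function \<open>\<rho>\<close> exists and lies above every minorant of \<open>w\<close>.
  Every extension of \<open>w\<close> is a minorant, so \<open>\<rho>\<close> lies above all extensions; and on an edge \<open>\<rho>\<close> is
  squeezed between \<open>w\<close> and any one extension, whose value there is again \<open>w\<close>. Hence \<open>\<rho>\<close> is itself
  an extension.

  If \<open>G\<close> is disconnected, no extension is maximal. A connected component \<open>C\<close> is crossed by no
  edge (\<open>disconnected_uncrossed_cut\<close>), so the distances across \<open>C\<close> are not controlled by \<open>w\<close>:
  the pointwise maximum of an extension with the pseudoultrametric that is constantly \<open>K\<close> across
  \<open>C\<close> and zero elsewhere is again an extension, and for \<open>K\<close> large it exceeds the original one at
  a pair separated by \<open>C\<close>.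
\<close>

lemma minorantsD:
  assumes "d \<in> minorants G w"
  shows "d \<in> pseudoultrametrics (verts G)" and "{u, v} \<in> edges G \<Longrightarrow> d (u, v) \<le> w {u, v}"
  using assms by (auto simp: minorants_def)

lemma extensions_subset_minorants: "extensions G w \<subseteq> minorants G w"
  by (auto simp: extensions_def extends_def minorants_def)

lemma greatest_minorant_is_greatest_extension:
  assumes G: "simple_graph G"
    and ext: "d \<in> extensions G w"
    and \<rho>: "greatest (pseudoultrametric_order (verts G)) \<rho> (minorants G w)"
  shows "greatest (pseudoultrametric_order (verts G)) \<rho> (extensions G w)"
proof -
  have mem: "\<rho> \<in> minorants G w"
    and ub: "\<And>d x y. d \<in> minorants G w \<Longrightarrow> x \<in> verts G \<Longrightarrow> y \<in> verts G \<Longrightarrow> d (x, y) \<le> \<rho> (x, y)"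
    using \<rho> by (auto simp: greatest_iff)
  have "\<rho> (u, v) = w {u, v}" if e: "{u, v} \<in> edges G" for u v
  proof (rule antisym)
    show "\<rho> (u, v) \<le> w {u, v}" using minorantsD(2)[OF mem e] .
    have "w {u, v} = d (u, v)" using ext e by (simp add: extensions_def extends_def)
    also have "\<dots> \<le> \<rho> (u, v)"
      using ub ext extensions_subset_minorants edgeD[OF G e] by blast
    finally show "w {u, v} \<le> \<rho> (u, v)" .
  qed
  then have "\<rho> \<in> extensions G w"
    using minorantsD(1)[OF mem] by (simp add: extensions_def extends_def)
  then show ?thesis
    using ub extensions_subset_minorants[of G w] by (auto simp: greatest_iff extensions_def)
qed

text \<open>
  The cut \<open>C\<close> is the component of one endpoint of a pair that no path connects. Reachability is
  taken with respect to the zero weight and threshold, for which \<open>thr\<close> contains every edge.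
\<close>

lemma disconnected_uncrossed_cut:
  assumes G: "simple_graph G" and "\<not> connected_graph G"
  obtains C x y where "x \<in> verts G" "y \<in> verts G" "x \<in> C" "y \<notin> C"
    "\<And>u v. {u, v} \<in> edges G \<Longrightarrow> u \<in> C \<longleftrightarrow> v \<in> C"
proof -
  obtain x y where xy: "x \<in> verts G" "y \<in> verts G" "x \<noteq> y" "paths_between G x y = {}"
    using assms(2) by (auto simp: connected_graph_def)
  let ?R = "thr G (\<lambda>_. 0) 0"
  let ?C = "{v. (x, v) \<in> ?R\<^sup>*}"
  have "y \<notin> ?C" using rtrancl_path[OF G _ xy(3)] xy(4) by blast
  moreover have "u \<in> ?C \<longleftrightarrow> v \<in> ?C" if "{u, v} \<in> edges G" for u v
  proof -
    have "(u, v) \<in> ?R" "(v, u) \<in> ?R" using that by (auto simp: thr_def insert_commute)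
    then show ?thesis by (auto intro: rtrancl_into_rtrancl)
  qed
  ultimately show ?thesis using that[of x y ?C] xy by blast
qed

definition raise_across :: "'a set \<Rightarrow> 'a set \<Rightarrow> real \<Rightarrow> ('a \<times> 'a \<Rightarrow> real) \<Rightarrow> 'a \<times> 'a \<Rightarrow> real" where
  "raise_across X C K d =
     (\<lambda>(x, y) \<in> X \<times> X. if x \<in> C \<longleftrightarrow> y \<in> C then d (x, y) else max (d (x, y)) K)"

text \<open>
  Raising distances can break the inequality \<open>d (x, y) \<le> max (d (x, z)) (d (z, y))\<close> only if \<open>x\<close>
  and \<open>y\<close> are separated by \<open>C\<close>; but then so are \<open>x, z\<close> or \<open>z, y\<close>, and the right-hand side is
  raised to at least \<open>K\<close> as well.
\<close>

lemma raise_across_pseudoultrametric: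
  assumes d: "d \<in> pseudoultrametrics X"
  shows "raise_across X C K d \<in> pseudoultrametrics X"
proof -
  let ?r = "raise_across X C K d"
  have r: "?r (x, y) = (if x \<in> C \<longleftrightarrow> y \<in> C then d (x, y) else max (d (x, y)) K)"
    if "x \<in> X" "y \<in> X" for x y using that by (simp add: raise_across_def)
  have "?r (x, y) \<le> max (?r (x, z)) (?r (z, y))" if "x \<in> X" "y \<in> X" "z \<in> X" for x y z
    using pseudoultrametricsD(5)[OF d that] by (auto simp: r that)
  moreover have "0 \<le> ?r (x, y)" if "x \<in> X" "y \<in> X" for x y
    using pseudoultrametricsD(2)[OF d that] by (auto simp: r that)
  moreover have "?r (x, y) = ?r (y, x)" if "x \<in> X" "y \<in> X" for x y
    using pseudoultrametricsD(3)[OF d that] by (auto simp: r that)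
  moreover have "?r (x, x) = 0" if "x \<in> X" for x
    using pseudoultrametricsD(4)[OF d that] by (simp add: r that)
  moreover have "?r \<in> extensional (X \<times> X)" by (simp add: raise_across_def)
  ultimately show ?thesis by (auto simp: pseudoultrametrics_def PiE_iff)
qed

lemma greatest_extension_imp_connected:
  assumes G: "simple_graph G"
    and \<rho>: "greatest (pseudoultrametric_order (verts G)) \<rho> (extensions G w)"
  shows "connected_graph G"
proof (rule ccontr)
  assume "\<not> connected_graph G"
  then obtain C x y where xy: "x \<in> verts G" "y \<in> verts G" "x \<in> C" "y \<notin> C"
    and uncrossed: "\<And>u v. {u, v} \<in> edges G \<Longrightarrow> u \<in> C \<longleftrightarrow> v \<in> C"
    by (rule disconnected_uncrossed_cut[OF G]) blast
  let ?d = "raise_across (verts G) C (\<rho> (x, y) + 1) \<rho>"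
  have ext: "\<rho> \<in> extensions G w"
    and ub: "\<And>d. d \<in> extensions G w \<Longrightarrow> d (x, y) \<le> \<rho> (x, y)"
    using \<rho> xy by (auto simp: greatest_iff)
  have "?d (u, v) = w {u, v}" if e: "{u, v} \<in> edges G" for u v
    using uncrossed[OF e] edgeD[OF G e] ext e
    by (simp add: raise_across_def extensions_def extends_def)
  then have "?d \<in> extensions G w"
    using ext by (auto simp: extensions_def extends_def intro: raise_across_pseudoultrametric)
  then have "?d (x, y) \<le> \<rho> (x, y)" by (rule ub)
  moreover have "?d (x, y) = \<rho> (x, y) + 1" using xy by (simp add: raise_across_def)
  ultimately show False by simp
qed

theorem theorem3p7:
  fixes G :: "'a graph" and w :: "'a set \<Rightarrow> real"
  assumes "weighted_graph G w"
    and "pseudoultrametrizable G w"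
  shows "(connected_graph G \<longrightarrow>
            greatest (pseudoultrametric_order (verts G)) (subdominant G w) (extensions G w)) \<and>
         ((\<exists>\<rho>. greatest (pseudoultrametric_order (verts G)) \<rho> (extensions G w)) \<longrightarrow>
            connected_graph G)"
proof (intro conjI impI)
  have G: "simple_graph G" using assms(1) by (simp add: weighted_graph_def)
  {
    assume C: "connected_graph G"
    obtain d where "d \<in> extensions G w"
      using assms(2) by (auto simp: pseudoultrametrizable_def extensions_def)
    then show "greatest (pseudoultrametric_order (verts G)) (subdominant G w) (extensions G w)"
      unfolding subdominant_eq_path_inf[OF assms(1) C]
      by (rule greatest_minorant_is_greatest_extension
            [OF G _ greatest_minorant_path_inf[OF assms(1) C]])
  next
    assume "\<exists>\<rho>. greatest (pseudoultrametric_order (verts G)) \<rho> (extensions G w)"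
    then show "connected_graph G" using greatest_extension_imp_connected[OF G] by blast
  }
qed

end
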